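(* Let $m\ge 2$, let $n\ge 3$ be an odd integer, and let $r$ be an integer with $n>r\ge 3$. Then $\chi_{lat}(A(mK_n,K_r))=n$.
   Context: All graphs are finite and simple. For a graph $G$ with $p$ vertices and $q$ edges, a local antimagic total labeling of $G$ is a bijection $f:V(G)\cup E(G)\to\{1,2,\ldots,p+q\}$ such that $w_f(u)\neq w_f(v)$ for every edge $uv\in E(G)$, where $w_f(u)=f(u)+\sum_{uv\in E(G)}f(uv)$ is the weight of $u$ (the sum is over all edges incident to $u$). The local antimagic total chromatic number $\chi_{lat}(G)$ is the minimum, over all local antimagic total labelings $f$ of $G$, of the number of distinct values of $w_f$ on $V(G)$. (It is known that every graph has a local antimagic total labeling.) For $m\ge 2$ and $n>r\ge 1$, $A(mK_n,K_r)$ denotes the amalgamation of $m$ copies of the complete graph $K_n$ over $K_r$: the simple graph obtained from $m$ copies of $K_n$ by choosing a $K_r$ in each copy and identifying these $m$ copies of $K_r$ into a single $K_r$. Equivalently, it is the join $(mK_{n-r})\vee K_r$, where $mK_{n-r}$ is the disjoint union of $m$ copies of $K_{n-r}$. *)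

theory Defs
  imports Main "HOL-Library.Ramsey"
begin

text \<open>
  A graph is a pair of a vertex set and a set of edges, an edge being an unordered pair of
  distinct vertices. Here \<open>[V]\<^bsup>2\<^esup>\<close> (constant \<^const>\<open>nsets\<close>) is the set of
  all two-element subsets of \<open>V\<close>.
\<close>

type_synonym 'a graph = "'a set \<times> 'a set set"

abbreviation verts :: "'a graph \<Rightarrow> 'a set" where
  "verts \<equiv> fst"

abbreviation edges :: "'a graph \<Rightarrow> 'a set set" where
  "edges \<equiv> snd"

definition simple_graph :: "'a graph \<Rightarrow> bool" where
  "simple_graph G \<longleftrightarrow> finite (verts G) \<and> edges G \<subseteq> [verts G]\<^bsup>2\<^esup>"

definition complete_graph :: "'a set \<Rightarrow> 'a graph" where
  "complete_graph V = (V, [V]\<^bsup>2\<^esup>)"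


text \<open>
  A total labeling is a function on the disjoint sum of vertices and edges: \<open>f (Inl u)\<close> is
  the label of the vertex \<open>u\<close> and \<open>f (Inr e)\<close> that of the edge \<open>e\<close>.
\<close>

definition weight :: "'a graph \<Rightarrow> ('a + 'a set \<Rightarrow> nat) \<Rightarrow> 'a \<Rightarrow> nat" where
  "weight G f u = f (Inl u) + (\<Sum>e | e \<in> edges G \<and> u \<in> e. f (Inr e))"

definition local_antimagic_total :: "'a graph \<Rightarrow> ('a + 'a set \<Rightarrow> nat) \<Rightarrow> bool" where
  "local_antimagic_total G f \<longleftrightarrow>
     bij_betw f (verts G <+> edges G) {1..card (verts G) + card (edges G)} \<and>
     (\<forall>u v. {u, v} \<in> edges G \<longrightarrow> weight G f u \<noteq> weight G f v)"

definition chi_lat :: "'a graph \<Rightarrow> nat" where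
  "chi_lat G = (LEAST k. \<exists>f. local_antimagic_total G f \<and> k = card (weight G f ` verts G))"


definition copies :: "nat \<Rightarrow> 'a graph \<Rightarrow> (nat \<times> 'a) graph" where
  "copies m G = ({..<m} \<times> verts G, \<Union>i<m. image (Pair i) ` edges G)"

text \<open>
  The image of a graph under a vertex map \<open>h\<close>: vertices with the same value of \<open>h\<close> are
  identified, and so are edges that become equal.
\<close>

definition map_graph :: "('a \<Rightarrow> 'b) \<Rightarrow> 'a graph \<Rightarrow> 'b graph" where
  "map_graph h G = (h ` verts G, image h ` edges G)"

text \<open>
  The vertices of \<open>K\<^sub>n\<close> are \<open>0, \<dots>, n - 1\<close>, and the chosen \<open>K\<^sub>r\<close> in each copy
  consists of those below \<open>r\<close>. All copies \<open>(i, j)\<close> of a vertex \<open>j < r\<close> are identified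
  with the representative \<open>(0, j)\<close>.
\<close>

definition glue :: "nat \<Rightarrow> nat \<times> nat \<Rightarrow> nat \<times> nat" where
  "glue r = (\<lambda>(i, j). if j < r then (0, j) else (i, j))"

definition amalgamation :: "nat \<Rightarrow> nat \<Rightarrow> nat \<Rightarrow> (nat \<times> nat) graph" where
  "amalgamation m n r = map_graph (glue r) (copies m (complete_graph {..<n}))"


lemma doubleton_in_nsets_2 [simp]: "{x, y} \<in> [V]\<^bsup>2\<^esup> \<longleftrightarrow> x \<in> V \<and> y \<in> V \<and> x \<noteq> y"
  by (auto simp: nsets_def card_insert_if)

lemma verts_amalgamation:
  assumes "m \<ge> 1" "r < n"
  shows "verts (amalgamation m n r) = {0} \<times> {..<r} \<union> {..<m} \<times> {r..<n}"
proof -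
  have "verts (amalgamation m n r) = glue r ` ({..<m} \<times> {..<n})"
    by (simp add: amalgamation_def map_graph_def copies_def complete_graph_def)
  also have "\<dots> = {0} \<times> {..<r} \<union> {..<m} \<times> {r..<n}"
  proof (intro equalityI subsetI)
    fix x assume "x \<in> {0} \<times> {..<r} \<union> {..<m} \<times> {r..<n}"
    then have "x = glue r x" "x \<in> {..<m} \<times> {..<n}"
      using assms by (auto simp: glue_def)
    then show "x \<in> glue r ` ({..<m} \<times> {..<n})" by blast
  qed (auto simp: glue_def split: if_splits)
  finally show ?thesis .
qed

lemma edges_amalgamation_iff:
  "e \<in> edges (amalgamation m n r) \<longleftrightarrow>
     (\<exists>i j k. i < m \<and> j < n \<and> k < n \<and> j \<noteq> k \<and> e = {glue r (i, j), glue r (i, k)})"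
    (is "?L \<longleftrightarrow> ?R")
proof
  assume ?L
  then obtain i d where "i < m" "d \<in> [{..<n}]\<^bsup>2\<^esup>" "e = glue r ` Pair i ` d"
    by (auto simp: amalgamation_def map_graph_def copies_def complete_graph_def)
  moreover from this obtain j k where "d = {j, k}" "j \<noteq> k" "j < n" "k < n"
    by (auto simp: nsets_def card_2_iff)
  ultimately show ?R by auto
next
  assume ?R
  then obtain i j k where *: "i < m" "j < n" "k < n" "j \<noteq> k"
    "e = glue r ` Pair i ` {j, k}" by auto
  then have "{j, k} \<in> [{..<n}]\<^bsup>2\<^esup>" by simp
  with \<open>i < m\<close> have "Pair i ` {j, k} \<in> edges (copies m (complete_graph {..<n}))"
    unfolding copies_def complete_graph_def snd_conv by blast
  then show ?L
    unfolding *(5) amalgamation_def map_graph_def snd_conv by (rule imageI)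
qed

text \<open>
  The amalgamation is the join \<open>(m K\<^bsub>n-r\<^esub>) \<or> K\<^sub>r\<close>: two distinct vertices are
  adjacent unless they lie outside the common \<open>K\<^sub>r\<close> and in different copies.
\<close>

lemma adjacent_amalgamation_iff:
  assumes "m \<ge> 1" "r < n"
  shows "{x, y} \<in> edges (amalgamation m n r) \<longleftrightarrow>
     x \<in> verts (amalgamation m n r) \<and> y \<in> verts (amalgamation m n r) \<and> x \<noteq> y \<and>
     (snd x < r \<or> snd y < r \<or> fst x = fst y)" (is "?L \<longleftrightarrow> ?R")
proof
  assume ?L
  then show ?R
    unfolding edges_amalgamation_iff verts_amalgamation[OF assms]
    using assms by (auto simp: glue_def doubleton_eq_iff split: if_splits)
next
  assume ?R
  moreover define i where "i = (if snd x < r then fst y else fst x)"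
  ultimately have "i < m" "snd x < n" "snd y < n" "snd x \<noteq> snd y"
    "x = glue r (i, snd x)" "y = glue r (i, snd y)"
    unfolding verts_amalgamation[OF assms]
    using assms by (auto simp: glue_def split: if_splits)
  then show ?L
    unfolding edges_amalgamation_iff by metis
qed

lemma simple_graph_amalgamation: "simple_graph (amalgamation m n r)"
proof -
  have v: "verts (amalgamation m n r) = glue r ` ({..<m} \<times> {..<n})"
    by (simp add: amalgamation_def map_graph_def copies_def complete_graph_def)
  have "e \<in> [verts (amalgamation m n r)]\<^bsup>2\<^esup>" if "e \<in> edges (amalgamation m n r)" for e
  proof -
    obtain i j k where *: "i < m" "j < n" "k < n" "j \<noteq> k" "e = {glue r (i, j), glue r (i, k)}"
      using \<open>e \<in> _\<close> unfolding edges_amalgamation_iff by blast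
    then have "glue r (i, j) \<noteq> glue r (i, k)" by (auto simp: glue_def)
    with * show ?thesis unfolding v by auto
  qed
  then show ?thesis by (auto simp: simple_graph_def v)
qed

end

theory Submission
  imports Defs
begin

text \<open>
  The amalgamation contains a clique of \<open>n\<close> vertices, so every local antimagic total labeling has at
  least \<open>n\<close> weights (lemma \<open>amalgamation_weights_ge\<close>). The work is in a labeling with exactly
  \<open>n\<close> weights.

  Number the vertices of each \<open>K\<^sub>n\<close> from \<open>0\<close> to \<open>n - 1\<close> so that the \<open>s = n - r\<close> vertices
  outside the common \<open>K\<^sub>r\<close> come first. A total labeling then amounts to \<open>m\<close> symmetric
  \<open>n \<times> n\<close> matrices, one for each copy, with the vertex labels on the diagonal; these matrices share
  the block with both indices at least \<open>s\<close>, and a vertex below \<open>s\<close> has as its weight a row sum of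
  the matrix of its copy. Two properties give \<open>n\<close> weights (lemma \<open>labeling_of_pattern\<close>):
  the row sums of the rows below \<open>s\<close> do not depend on the copy, and in each matrix the entries
  increase, the diagonal ones with the row and the others lexicographically in
  (smaller index, larger index). By monotonicity each row dominates the rows above it, so the weights
  increase strictly with the vertex number, and so do those in the common \<open>K\<^sub>r\<close>, whose weights only
  collect further labels from the other copies.

  To get monotone matrices, the entry at each position outside the shared block receives over the \<open>m\<close>
  copies one block of \<open>m\<close> consecutive labels, the blocks being laid out in lexicographic order. Inside
  its block an entry ascends or descends with the copy, that is, it has slope \<open>1\<close> or \<open>-1\<close>, and a row
  sum is constant if the slopes cancel. As \<open>n\<close> is odd, slopes \<open>\<plusminus>1\<close> alone cannot cancel. So the rows
  below \<open>s\<close> are paired up, and the two diagonal entries of a pair share \<open>2 m\<close> labels in an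
  interleaved way, which gives both of them slope \<open>2\<close>; the other slopes of the row are chosen to have sum
  \<open>-2\<close> (lemma \<open>row_sum_low\<close>).

  If \<open>s\<close> is odd, row \<open>s - 1\<close> has no partner. There three entries run through a
  \<open>3 \<times> (2 h + 1)\<close> Kotzig array, three permutations of \<open>{0..2 h}\<close> with constant column sums, where
  \<open>h = m div 2\<close> (lemma \<open>row_sum_last\<close>). For odd \<open>m\<close> its width is \<open>m\<close>. For even \<open>m\<close> the width is
  \<open>m + 1\<close>: one column is not used, and its three labels go to the first three vertices of the common
  \<open>K\<^sub>r\<close>. Since the diagonal is compared only with the diagonal, these small labels do not
  disturb the monotonicity.
\<close>

section \<open>From matrices to labelings\<close>

text \<open>
  The vertex with number \<open>u\<close> in copy \<open>i\<close>. The order of the second components is reversed, so that the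
  common \<open>K\<^sub>r\<close> consists of the numbers from \<open>n - r\<close> on and receives the largest labels.
\<close>

definition vtx :: "nat \<Rightarrow> nat \<Rightarrow> nat \<Rightarrow> nat \<Rightarrow> nat \<times> nat" where
  "vtx n r i u = glue r (i, n - 1 - u)"

text \<open>
  The positions of the matrices on and above the diagonal, those of the shared block being listed only
  with copy \<open>0\<close>. They are in bijection with the vertices (\<open>u = v\<close>) and edges (\<open>u < v\<close>).
\<close>

definition cells :: "nat \<Rightarrow> nat \<Rightarrow> nat \<Rightarrow> (nat \<times> nat \<times> nat) set" where
  "cells m n s = {(i, u, v). u \<le> v \<and> v < n \<and> i < m \<and> (s \<le> u \<longrightarrow> i = 0)}"

definition row_sum :: "(nat \<Rightarrow> nat \<Rightarrow> nat \<Rightarrow> nat) \<Rightarrow> nat \<Rightarrow> nat \<Rightarrow> nat \<Rightarrow> nat" where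
  "row_sum L n i u = (\<Sum>v<n. L i (min u v) (max u v))"

lemma vtx_eq_iff:
  assumes "r < n" "u < n" "v < n"
  shows "vtx n r i u = vtx n r k v \<longleftrightarrow> u = v \<and> (i = k \<or> n - r \<le> u)"
  using assms by (auto simp: vtx_def glue_def)

lemma edges_vtx_iff:
  assumes "r < n"
  shows "e \<in> edges (amalgamation m n r) \<longleftrightarrow>
    (\<exists>i u v. i < m \<and> u < n \<and> v < n \<and> u \<noteq> v \<and> e = {vtx n r i u, vtx n r i v})" (is "?L \<longleftrightarrow> ?R")
proof
  assume ?L
  then obtain i j k where *: "i < m" "j < n" "k < n" "j \<noteq> k" "e = {glue r (i, j), glue r (i, k)}"
    unfolding edges_amalgamation_iff by blast
  then show ?R
    by (intro exI[of _ i] exI[of _ "n - 1 - j"] exI[of _ "n - 1 - k"]) (auto simp: vtx_def)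
next
  assume ?R
  then obtain i u v where *: "i < m" "u < n" "v < n" "u \<noteq> v" "e = {vtx n r i u, vtx n r i v}"
    by blast
  then have "n - 1 - u < n" "n - 1 - v < n" "n - 1 - u \<noteq> n - 1 - v" by auto
  with * show ?L unfolding edges_amalgamation_iff vtx_def by blast
qed

lemma verts_vtx:
  assumes "r < n" "1 \<le> m"
  shows "verts (amalgamation m n r) = {vtx n r i u | i u. i < m \<and> u < n}"
proof -
  have "verts (amalgamation m n r) = glue r ` ({..<m} \<times> {..<n})"
    by (simp add: amalgamation_def map_graph_def copies_def complete_graph_def)
  also have "\<dots> = {vtx n r i u | i u. i < m \<and> u < n}"
  proof (intro equalityI subsetI)
    fix x assume "x \<in> glue r ` ({..<m} \<times> {..<n})"
    then obtain i j where *: "i < m" "j < n" "x = glue r (i, j)" by auto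
    then have "x = vtx n r i (n - 1 - j)" "n - 1 - j < n" by (auto simp: vtx_def)
    with * show "x \<in> {vtx n r i u | i u. i < m \<and> u < n}" by blast
  next
    fix x assume "x \<in> {vtx n r i u | i u. i < m \<and> u < n}"
    then obtain i u where *: "i < m" "u < n" "x = vtx n r i u" by auto
    then show "x \<in> glue r ` ({..<m} \<times> {..<n})" unfolding vtx_def
      by (intro image_eqI[of _ _ "(i, n - 1 - u)"]) auto
  qed
  finally show ?thesis .
qed

definition cell_elem :: "nat \<Rightarrow> nat \<Rightarrow> nat \<times> nat \<times> nat \<Rightarrow> (nat \<times> nat) + (nat \<times> nat) set" where
  "cell_elem n r = (\<lambda>(i, u, v). if u = v then Inl (vtx n r i u) else Inr {vtx n r i u, vtx n r i v})"

text \<open>Normalises the copy of a position in the shared block to \<open>0\<close>.\<close>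

lemma cell_elem_reduce:
  assumes "r < n" "i < m" "u \<le> v" "v < n"
  defines "k \<equiv> if n - r \<le> u then 0 else i"
  shows "(k, u, v) \<in> cells m n (n - r)" "cell_elem n r (k, u, v) = cell_elem n r (i, u, v)"
proof -
  show "(k, u, v) \<in> cells m n (n - r)" using assms by (auto simp: cells_def)
  have "vtx n r k u = vtx n r i u" "vtx n r k v = vtx n r i v"
    using assms by (auto simp: vtx_eq_iff)
  then show "cell_elem n r (k, u, v) = cell_elem n r (i, u, v)"
    by (auto simp: cell_elem_def)
qed

lemma bij_betw_cell_elem:
  assumes "r < n" "1 \<le> m"
  shows "bij_betw (cell_elem n r) (cells m n (n - r))
    (verts (amalgamation m n r) <+> edges (amalgamation m n r))"
  unfolding bij_betw_def
proof (intro conjI equalityI subsetI)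
  show "inj_on (cell_elem n r) (cells m n (n - r))"
  proof (rule inj_onI, clarsimp simp: cells_def)
    fix i u v i' u' v'
    assume *: "cell_elem n r (i, u, v) = cell_elem n r (i', u', v')"
      "u \<le> v" "v < n" "n - r \<le> u \<longrightarrow> i = 0" "u' \<le> v'" "v' < n" "n - r \<le> u' \<longrightarrow> i' = 0"
    from * show "i = i' \<and> u = u' \<and> v = v'" using assms
      by (auto simp: cell_elem_def vtx_eq_iff doubleton_eq_iff split: if_splits)
  qed
next
  fix y assume "y \<in> cell_elem n r ` cells m n (n - r)"
  then obtain i u v where *: "u \<le> v" "v < n" "i < m" and y: "y = cell_elem n r (i, u, v)"
    by (auto simp: cells_def)
  show "y \<in> verts (amalgamation m n r) <+> edges (amalgamation m n r)"
  proof (cases "u = v")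
    case True
    with * show ?thesis using assms by (auto simp: y cell_elem_def verts_vtx)
  next
    case False
    with * have "{vtx n r i u, vtx n r i v} \<in> edges (amalgamation m n r)"
      unfolding edges_vtx_iff[OF assms(1)]
      by (intro exI[of _ i] exI[of _ u] exI[of _ v]) auto
    with False show ?thesis by (auto simp: y cell_elem_def)
  qed
next
  fix y assume "y \<in> verts (amalgamation m n r) <+> edges (amalgamation m n r)"
  then have "\<exists>i u v. i < m \<and> u \<le> v \<and> v < n \<and> y = cell_elem n r (i, u, v)"
  proof (elim PlusE)
    fix x assume "x \<in> verts (amalgamation m n r)" "y = Inl x"
    then obtain i u where "i < m" "u < n" "y = Inl (vtx n r i u)"
      using assms by (auto simp: verts_vtx)
    then show ?thesis by (intro exI[of _ i] exI[of _ u]) (auto simp: cell_elem_def)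
  next
    fix e assume "e \<in> edges (amalgamation m n r)" "y = Inr e"
    then obtain i u v where *: "i < m" "u < n" "v < n" "u \<noteq> v"
      "y = Inr {vtx n r i u, vtx n r i v}"
      using assms by (auto simp: edges_vtx_iff)
    then have "y = cell_elem n r (i, min u v, max u v)"
      by (auto simp: cell_elem_def min_def max_def)
    with * show ?thesis
      by (intro exI[of _ i] exI[of _ "min u v"] exI[of _ "max u v"]) auto
  qed
  then show "y \<in> cell_elem n r ` cells m n (n - r)"
    by (metis cell_elem_reduce[OF assms(1)] image_eqI)
qed

lemma weight_via_neighbours:
  assumes "finite N" "\<And>e. e \<in> edges G \<and> x \<in> e \<longleftrightarrow> (\<exists>y\<in>N. e = {x, h y})"
    "inj_on h N" "\<And>y. y \<in> N \<Longrightarrow> h y \<noteq> x"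
  shows "weight G f x = f (Inl x) + (\<Sum>y\<in>N. f (Inr {x, h y}))"
proof -
  have "{e. e \<in> edges G \<and> x \<in> e} = (\<lambda>y. {x, h y}) ` N" using assms(2) by auto
  moreover have "inj_on (\<lambda>y. {x, h y}) N"
    using assms(3,4) by (auto simp: inj_on_def doubleton_eq_iff)
  ultimately show ?thesis unfolding weight_def by (simp add: sum.reindex)
qed

text \<open>
  Matching entries column by column, row \<open>v\<close> dominates row \<open>u\<close>: in a column other than \<open>u\<close> and \<open>v\<close>
  the position of row \<open>v\<close> is lexicographically later, the two diagonal entries are matched with each
  other, and the remaining entry \<open>{u, v}\<close> is common to both rows.
\<close>

lemma row_sum_less:
  assumes "u < v" "v < n" "L i u u < L i v v"
    and lex: "\<And>a b c d. a < b \<Longrightarrow> b < n \<Longrightarrow> c < d \<Longrightarrow> d < n \<Longrightarrow> a < c \<or> a = c \<and> b < d \<Longrightarrow>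
      L i a b < L i c d"
  shows "row_sum L n i u < row_sum L n i v"
proof -
  let ?S = "\<lambda>u v. L i (min u v) (max u v)"
  have split: "row_sum L n i w = ?S w u + ?S w v + (\<Sum>x\<in>{..<n} - {u, v}. ?S w x)" for w
  proof -
    have "row_sum L n i w = (\<Sum>x\<in>{u, v}. ?S w x) + (\<Sum>x\<in>{..<n} - {u, v}. ?S w x)"
      unfolding row_sum_def using assms(1,2)
      by (subst sum.subset_diff[of "{u, v}"]) auto
    then show ?thesis using assms(1) by simp
  qed
  have "(\<Sum>x\<in>{..<n} - {u, v}. ?S u x) \<le> (\<Sum>x\<in>{..<n} - {u, v}. ?S v x)"
  proof (rule sum_mono)
    fix x assume "x \<in> {..<n} - {u, v}"
    then show "?S u x \<le> ?S v x"
      using assms(1,2) by (intro less_imp_le lex) (auto simp: min_def max_def)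
  qed
  moreover have "?S u v = ?S v u" by (simp add: min.commute max.commute)
  ultimately show ?thesis unfolding split[of u] split[of v] using assms(3) by simp
qed

text \<open>
  The weight of vertex number \<open>u < s\<close> is the row sum of row \<open>u\<close> in its own copy, hence in copy \<open>0\<close>. The
  weight of \<open>u \<ge> s\<close> is the row sum in copy \<open>0\<close> plus the column entries above the shared block in the
  other copies, and this additional term increases with \<open>u\<close> as well.
\<close>

lemma labeling_of_pattern:
  fixes L :: "nat \<Rightarrow> nat \<Rightarrow> nat \<Rightarrow> nat"
  assumes "1 \<le> m" "r < n" and s: "s = n - r"
    and bij: "bij_betw (\<lambda>(i, u, v). L i u v) (cells m n s) {1..card (cells m n s)}"
    and core: "\<And>i u v. s \<le> u \<Longrightarrow> L i u v = L 0 u v"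
    and const: "\<And>i u. i < m \<Longrightarrow> u < s \<Longrightarrow> row_sum L n i u = row_sum L n 0 u"
    and diag: "\<And>u v. u < v \<Longrightarrow> v < n \<Longrightarrow> L 0 u u < L 0 v v"
    and lex: "\<And>i a b c d. i < m \<Longrightarrow> a < b \<Longrightarrow> b < n \<Longrightarrow> c < d \<Longrightarrow> d < n \<Longrightarrow>
      a < c \<or> a = c \<and> b < d \<Longrightarrow> L i a b < L i c d"
  obtains f where "local_antimagic_total (amalgamation m n r) f"
    "card (weight (amalgamation m n r) f ` verts (amalgamation m n r)) = n"
proof -
  define G where "G = amalgamation m n r"
  define \<phi> where "\<phi> = cell_elem n r"
  \<comment> \<open>Transporting the labels along the bijection avoids decoding copies and numbers from an edge.\<close>
  define f where "f = (\<lambda>(i, u, v). L i u v) \<circ> inv_into (cells m n s) \<phi>"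
  have phi: "bij_betw \<phi> (cells m n s) (verts G <+> edges G)"
    using bij_betw_cell_elem[OF assms(2,1)] by (simp add: \<phi>_def G_def s)
  have f_phi: "f (\<phi> (i, u, v)) = L i u v" if "i < m" "u \<le> v" "v < n" for i u v
  proof -
    define k where "k = (if n - r \<le> u then 0 else i)"
    have k: "(k, u, v) \<in> cells m n (n - r)" "\<phi> (k, u, v) = \<phi> (i, u, v)"
      using cell_elem_reduce[OF assms(2) that] by (simp_all add: k_def \<phi>_def)
    have "f (\<phi> (k, u, v)) = L k u v"
      using k(1) phi by (simp add: f_def s bij_betw_def)
    moreover have "L k u v = L i u v" using core[of u i v] by (simp add: k_def s)
    ultimately show ?thesis using k(2) by simp
  qed
  have f_vtx: "f (Inl (vtx n r i u)) = L i u u" if "i < m" "u < n" for i u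
    using f_phi[of i u u] that by (simp add: \<phi>_def cell_elem_def)
  have f_edge: "f (Inr {vtx n r i u, vtx n r i v}) = L i (min u v) (max u v)"
    if "i < m" "u < n" "v < n" "u \<noteq> v" for i u v
    using f_phi[of i "min u v" "max u v"] that
    by (auto simp: \<phi>_def cell_elem_def min_def max_def insert_commute split: if_splits)
  have fbij: "bij_betw f (verts G <+> edges G) {1..card (verts G) + card (edges G)}"
  proof -
    have "finite (verts G)" "finite (edges G)"
      using simple_graph_amalgamation[of m n r] finite_subset[OF _ finite_imp_finite_nsets]
      by (auto simp: simple_graph_def G_def)
    then have "card (verts G) + card (edges G) = card (cells m n s)"
      using bij_betw_same_card[OF phi] by (simp add: card_Plus)
    moreover have "bij_betw f (verts G <+> edges G) {1..card (cells m n s)}"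
      unfolding f_def by (rule bij_betw_trans[OF bij_betw_inv_into[OF phi] bij])
    ultimately show ?thesis by simp
  qed
  \<comment> \<open>The contribution of the copies other than \<open>0\<close> to the weight of a vertex of the common \<open>K\<^sub>r\<close>.\<close>
  define ext where "ext u = (\<Sum>i\<in>{1..<m}. \<Sum>v<s. L i v u)" for u
  define \<omega> where "\<omega> u = row_sum L n 0 u + (if u < s then 0 else ext u)" for u
  have w_copy: "weight G f (vtx n r i u) = \<omega> u" if i: "i < m" and u: "u < s" for i u
  proof -
    have un: "u < n" using u s by simp
    have "weight G f (vtx n r i u) = f (Inl (vtx n r i u)) +
       (\<Sum>v\<in>{..<n} - {u}. f (Inr {vtx n r i u, vtx n r i v}))"
    proof (rule weight_via_neighbours[where N = "{..<n} - {u}" and h = "vtx n r i"])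
      fix e show "e \<in> edges G \<and> vtx n r i u \<in> e \<longleftrightarrow>
        (\<exists>v\<in>{..<n} - {u}. e = {vtx n r i u, vtx n r i v})" (is "?l \<longleftrightarrow> ?r")
      proof
        assume ?l
        then obtain k a b where *: "k < m" "a < n" "b < n" "a \<noteq> b" "e = {vtx n r k a, vtx n r k b}"
          "vtx n r i u \<in> e" unfolding G_def edges_vtx_iff[OF assms(2)] by blast
        from *(6) have "vtx n r i u = vtx n r k a \<or> vtx n r i u = vtx n r k b"
          unfolding *(5) by simp
        then have "k = i \<and> (u = a \<or> u = b)"
          using u un s *(2,3) assms(2) by (simp add: vtx_eq_iff) linarith
        then have "e = {vtx n r i u, vtx n r i (if u = a then b else a)}"
          unfolding *(5) by auto
        with *(2-4) show ?r by (intro bexI[of _ "if u = a then b else a"]) auto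
      next
        assume ?r
        then obtain v where *: "v < n" "v \<noteq> u" "e = {vtx n r i u, vtx n r i v}" by auto
        then have "e \<in> edges G" unfolding G_def edges_vtx_iff[OF assms(2)]
          using i un by (intro exI[of _ i] exI[of _ u] exI[of _ v]) auto
        with * show ?l by simp
      qed
    qed (use assms(2) un in \<open>auto simp: inj_on_def vtx_eq_iff\<close>)
    also have "\<dots> = L i (min u u) (max u u) + (\<Sum>v\<in>{..<n} - {u}. L i (min u v) (max u v))"
      using i un by (simp add: f_vtx f_edge)
    also have "\<dots> = row_sum L n i u"
      unfolding row_sum_def using un by (subst (2) sum.remove[of _ u]) auto
    finally show ?thesis using const[OF i u] u by (simp add: \<omega>_def)
  qed
  have w_core: "weight G f (vtx n r i u) = \<omega> u" if i: "i < m" and u: "s \<le> u" "u < n" for i u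
  proof -
    let ?S = "\<lambda>i v. L i (min u v) (max u v)"
    let ?A = "{0} \<times> ({s..<n} - {u})" and ?B = "{..<m} \<times> {..<s}"
    have i0: "vtx n r i u = vtx n r k u" for k
      using u assms(2) s by (simp add: vtx_eq_iff)
    let ?x = "vtx n r 0 u"
    have "weight G f ?x = f (Inl ?x) + (\<Sum>y\<in>?A \<union> ?B. f (Inr {?x, case y of (i, v) \<Rightarrow> vtx n r i v}))"
    proof (rule weight_via_neighbours[where N = "?A \<union> ?B" and h = "\<lambda>y. case y of (i, v) \<Rightarrow> vtx n r i v"])
      fix e show "e \<in> edges G \<and> ?x \<in> e \<longleftrightarrow>
        (\<exists>y\<in>?A \<union> ?B. e = {?x, case y of (i, v) \<Rightarrow> vtx n r i v})" (is "?l \<longleftrightarrow> ?r")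
      proof
        assume ?l
        then obtain k a b where *: "k < m" "a < n" "b < n" "a \<noteq> b" "e = {vtx n r k a, vtx n r k b}"
          "?x \<in> e" unfolding G_def edges_vtx_iff[OF assms(2)] by blast
        from *(6) have "?x = vtx n r k a \<or> ?x = vtx n r k b" unfolding *(5) by simp
        then have "u = a \<or> u = b" using u *(2,3) assms(2) by (auto simp: vtx_eq_iff)
        define v where "v = (if u = a then b else a)"
        have v: "v < n" "v \<noteq> u" "e = {vtx n r k u, vtx n r k v}"
          using \<open>u = a \<or> u = b\<close> *(2-4) unfolding *(5) v_def by auto
        have kx: "vtx n r k u = ?x" using i0[of k] i0[of 0] by simp
        show ?r
        proof (cases "v < s")
          case True
          then show ?thesis using v kx * by (intro bexI[of _ "(k, v)"]) auto
        next
          case False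
          then have "vtx n r k v = vtx n r 0 v" using v assms(2) s by (simp add: vtx_eq_iff)
          then show ?thesis using v kx False by (intro bexI[of _ "(0, v)"]) auto
        qed
      next
        assume ?r
        then obtain k v where kv: "(k, v) \<in> ?A \<union> ?B" "e = {?x, vtx n r k v}"
          by (metis (no_types, lifting) old.prod.exhaust case_prod_conv)
        have *: "k < m" "v < n" "v \<noteq> u" using kv(1) assms(1) u s by auto
        have "?x = vtx n r k u" using i0[of k] i0[of 0] by simp
        with * have "e \<in> edges G" unfolding G_def edges_vtx_iff[OF assms(2)]
          using u kv(2) by (intro exI[of _ k] exI[of _ u] exI[of _ v]) auto
        with kv(2) show ?l by simp
      qed
    qed (use assms(2) u s in \<open>auto simp: inj_on_def vtx_eq_iff\<close>)
    also have "(\<Sum>y\<in>?A \<union> ?B. f (Inr {?x, case y of (i, v) \<Rightarrow> vtx n r i v})) = (\<Sum>(k, v)\<in>?A \<union> ?B. ?S k v)"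
    proof (rule sum.cong[OF refl], clarify)
      fix k v assume "(k, v) \<in> ?A \<union> ?B"
      then have "k < m" "v < n" "v \<noteq> u" using assms(1) u s by auto
      moreover have "?x = vtx n r k u" using i0[of k] i0[of 0] by simp
      ultimately show "f (Inr {?x, vtx n r k v}) = ?S k v" using u f_edge by simp
    qed
    also have "\<dots> = (\<Sum>(k, v)\<in>?A. ?S k v) + (\<Sum>(k, v)\<in>?B. ?S k v)"
      by (rule sum.union_disjoint) auto
    also have "(\<Sum>(k, v)\<in>?A. ?S k v) = (\<Sum>v\<in>{s..<n} - {u}. ?S 0 v)"
      by (subst sum.cartesian_product[symmetric]) simp
    also have "(\<Sum>(k, v)\<in>?B. ?S k v) = (\<Sum>k<m. \<Sum>v<s. ?S k v)"
      by (rule sum.cartesian_product[symmetric])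
    also have "\<dots> = (\<Sum>k<m. \<Sum>v<s. L k v u)"
      using u by (intro sum.cong) (auto simp: min_def max_def)
    also have "\<dots> = (\<Sum>v<s. L 0 v u) + ext u"
      unfolding ext_def lessThan_atLeast0 using assms(1) by (subst sum.atLeast_Suc_lessThan) auto
    also have "(\<Sum>v<s. L 0 v u) = (\<Sum>v<s. ?S 0 v)"
      using u by (intro sum.cong) (auto simp: min_def max_def)
    finally have "weight G f ?x = L 0 u u + (\<Sum>v\<in>{s..<n} - {u}. ?S 0 v) + (\<Sum>v<s. ?S 0 v) + ext u"
      using f_vtx[of 0 u] assms(1) u by simp
    also have "L 0 u u + (\<Sum>v\<in>{s..<n} - {u}. ?S 0 v) = (\<Sum>v\<in>{s..<n}. ?S 0 v)"
      using u by (subst (2) sum.remove[of _ u]) auto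
    also have "(\<Sum>v\<in>{s..<n}. ?S 0 v) + (\<Sum>v<s. ?S 0 v) = row_sum L n 0 u"
      unfolding row_sum_def lessThan_atLeast0
      using u sum.atLeastLessThan_concat[of 0 s n "?S 0"] by simp
    finally show ?thesis using u i0[of 0] by (simp add: \<omega>_def)
  qed
  have w: "weight G f (vtx n r i u) = \<omega> u" if "i < m" "u < n" for i u
    using w_copy w_core that by (metis not_le)
  have mono: "\<omega> u < \<omega> v" if "u < v" "v < n" for u v
  proof -
    have "row_sum L n 0 u < row_sum L n 0 v"
    proof (rule row_sum_less[where i = 0 and L = L, OF that diag[OF that]])
      show "L 0 a b < L 0 c d"
        if "a < b" "b < n" "c < d" "d < n" "a < c \<or> a = c \<and> b < d" for a b c d
        using lex[OF _ that] assms(1) by simp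
    qed
    moreover have "ext u \<le> ext v" if "s \<le> u"
      unfolding ext_def using that \<open>u < v\<close> \<open>v < n\<close>
      by (intro sum_mono less_imp_le lex) auto
    ultimately show ?thesis using that by (auto simp: \<omega>_def)
  qed
  have inj: "inj_on \<omega> {..<n}"
    by (rule inj_onI) (metis lessThan_iff linorder_neqE_nat mono order_less_irrefl)
  have "weight G f ` verts G = \<omega> ` {..<n}"
  proof (intro equalityI subsetI)
    fix y assume "y \<in> \<omega> ` {..<n}"
    then obtain u where "u < n" "y = weight G f (vtx n r 0 u)" using w assms(1) by auto
    moreover from this(1) have "vtx n r 0 u \<in> verts G"
      unfolding G_def verts_vtx[OF assms(2,1)] using assms(1)
      by (intro CollectI exI[of _ 0] exI[of _ u]) auto
    ultimately show "y \<in> weight G f ` verts G" by blast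
  qed (use w in \<open>auto simp: G_def verts_vtx[OF assms(2,1)]\<close>)
  then have "card (weight G f ` verts G) = n" using inj by (simp add: card_image)
  moreover have "local_antimagic_total G f"
    unfolding local_antimagic_total_def
  proof (intro conjI allI impI fbij)
    fix x y assume "{x, y} \<in> edges G"
    then obtain i u v where *: "i < m" "u < n" "v < n" "u \<noteq> v" "{x, y} = {vtx n r i u, vtx n r i v}"
      unfolding G_def edges_vtx_iff[OF assms(2)] by blast
    then have "{weight G f x, weight G f y} = {\<omega> u, \<omega> v}"
      using w by (auto simp: doubleton_eq_iff)
    moreover have "\<omega> u \<noteq> \<omega> v" using * inj by (auto simp: inj_on_def)
    ultimately show "weight G f x \<noteq> weight G f y" by (auto simp: doubleton_eq_iff)
  qed
  ultimately show thesis using that unfolding G_def by blast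
qed

section \<open>The lower bound\<close>

lemma local_antimagic_total_clique:
  assumes "local_antimagic_total G f" "finite (verts G)" "C \<subseteq> verts G"
    and "\<And>x y. x \<in> C \<Longrightarrow> y \<in> C \<Longrightarrow> x \<noteq> y \<Longrightarrow> {x, y} \<in> edges G"
  shows "card C \<le> card (weight G f ` verts G)"
proof -
  have "inj_on (weight G f) C"
    using assms(1,4) unfolding inj_on_def local_antimagic_total_def by blast
  then have "card C = card (weight G f ` C)" by (simp add: card_image)
  also have "\<dots> \<le> card (weight G f ` verts G)"
    using assms(2,3) by (intro card_mono) auto
  finally show ?thesis .
qed

lemma amalgamation_weights_ge:
  assumes "1 \<le> m" "r < n" "local_antimagic_total (amalgamation m n r) f"
  shows "n \<le> card (weight (amalgamation m n r) f ` verts (amalgamation m n r))"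
proof -
  have "inj_on (vtx n r 0) {..<n}" using assms by (auto simp: inj_on_def vtx_eq_iff)
  then have "n = card (vtx n r 0 ` {..<n})" by (simp add: card_image)
  also have "\<dots> \<le> card (weight (amalgamation m n r) f ` verts (amalgamation m n r))"
  proof (rule local_antimagic_total_clique[OF assms(3)])
    show "finite (verts (amalgamation m n r))"
      using simple_graph_amalgamation by (simp add: simple_graph_def)
    show "vtx n r 0 ` {..<n} \<subseteq> verts (amalgamation m n r)"
      using assms by (force simp: verts_vtx)
    fix x y assume "x \<in> vtx n r 0 ` {..<n}" "y \<in> vtx n r 0 ` {..<n}" "x \<noteq> y"
    then obtain u v where "u < n" "v < n" "u \<noteq> v" "x = vtx n r 0 u" "y = vtx n r 0 v" by auto
    then show "{x, y} \<in> edges (amalgamation m n r)"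
      unfolding edges_vtx_iff[OF assms(2)] using assms(1)
      by (intro exI[of _ 0] exI[of _ u] exI[of _ v]) auto
  qed
  finally show ?thesis .
qed

section \<open>Alternating signs, lexicographic positions and Kotzig arrays\<close>

definition alt :: "nat \<Rightarrow> int" where
  "alt v = (if even v then 1 else -1)"

lemma sum_alt: "(\<Sum>v = a..<a + 2 * k. alt v) = 0"
  by (induction k) (simp_all add: alt_def)

lemma sum_alt_even:
  assumes "a \<le> b" "even (b - a)"
  shows "(\<Sum>v = a..<b. alt v) = 0"
proof -
  from assms(2) obtain k where "b - a = 2 * k" by (elim evenE)
  then have "b = a + 2 * k" using assms(1) by simp
  then show ?thesis using sum_alt by simp
qed

text \<open>
  The position of \<open>(u, v)\<close> in the lexicographic list of all pairs \<open>u < v < n\<close>: row \<open>a\<close> contributes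
  \<open>n - 1 - a\<close> pairs.
\<close>

definition lex_start :: "nat \<Rightarrow> nat \<Rightarrow> nat" where
  "lex_start n u = (\<Sum>a<u. n - 1 - a)"

definition lex_index :: "nat \<Rightarrow> nat \<Rightarrow> nat \<Rightarrow> nat" where
  "lex_index n u v = lex_start n u + (v - u - 1)"

lemma lex_start_mono: "u \<le> u' \<Longrightarrow> lex_start n u \<le> lex_start n u'"
  unfolding lex_start_def by (intro sum_mono2) auto

lemma lex_index_less_start:
  assumes "u < v" "v < n" "u < k"
  shows "lex_index n u v < lex_start n k"
proof -
  have "lex_index n u v < lex_start n (Suc u)"
    using assms by (simp add: lex_index_def lex_start_def)
  also have "\<dots> \<le> lex_start n k" using assms by (intro lex_start_mono) simp
  finally show ?thesis .
qed

lemma lex_start_le_index: "k \<le> u \<Longrightarrow> lex_start n k \<le> lex_index n u v"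
  using lex_start_mono[of k u n] by (simp add: lex_index_def)

lemma lex_index_mono:
  assumes "a < b" "b < n" "c < d" "a < c \<or> a = c \<and> b < d"
  shows "lex_index n a b < lex_index n c d"
  using assms(4)
proof
  assume "a < c"
  then have "lex_index n a b < lex_start n c"
    using assms by (intro lex_index_less_start)
  also have "\<dots> \<le> lex_index n c d" by (rule lex_start_le_index) simp
  finally show ?thesis .
next
  assume "a = c \<and> b < d"
  then have "a = c" "b - a - 1 < d - c - 1" using assms(1) by auto
  then show ?thesis by (simp add: lex_index_def)
qed

lemma lex_index_inj:
  assumes "a < b" "b < n" "c < d" "d < n" "lex_index n a b = lex_index n c d"
  shows "a = c \<and> b = d"
proof -
  have "\<not> (a < c \<or> a = c \<and> b < d)" "\<not> (c < a \<or> c = a \<and> d < b)"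
    using lex_index_mono[of a b n c d] lex_index_mono[of c d n a b] assms by auto
  then show ?thesis by auto
qed

text \<open>
  Row \<open>t < 3\<close> and column \<open>i \<le> 2 h\<close> of a Kotzig array of width \<open>2 h + 1\<close>. The second row is the
  first one shifted cyclically by \<open>h\<close>. The sums of the two are \<open>h, h + 2, \<dots>, 3 h\<close> for \<open>i \<le> h\<close> and
  \<open>h + 1, h + 3, \<dots>, 3 h - 1\<close> after that, so they are distinct, and the third row, their complement to
  \<open>3 h\<close>, is a permutation of \<open>{0..2 h}\<close> again.
\<close>

definition kotzig :: "nat \<Rightarrow> nat \<Rightarrow> nat \<Rightarrow> nat" where
  "kotzig h t i =
    (if t = 0 then i
     else if t = 1 then (if i \<le> h then i + h else i - h - 1)
     else (if i \<le> h then 2 * h - 2 * i else 4 * h + 1 - 2 * i))"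

lemma kotzig_le: "i \<le> 2 * h \<Longrightarrow> kotzig h t i \<le> 2 * h"
  by (auto simp: kotzig_def)

lemma kotzig_inj: "i \<le> 2 * h \<Longrightarrow> j \<le> 2 * h \<Longrightarrow> kotzig h t i = kotzig h t j \<Longrightarrow> i = j"
  unfolding kotzig_def by (simp split: if_splits) presburger+

lemma kotzig_sum: "i \<le> 2 * h \<Longrightarrow> kotzig h 0 i + kotzig h 1 i + kotzig h 2 i = 3 * h"
  by (auto simp: kotzig_def)

section \<open>The labels\<close>

lemma card_cells:
  assumes "s \<le> n" "1 \<le> m"
  shows "card (cells m n s) = m * s + m * lex_start n s + (n - s) + (lex_start n n - lex_start n s)"
proof -
  let ?R = "\<lambda>u. {u..<n}"
  have "cells m n s = {..<m} \<times> Sigma {..<s} ?R \<union> {0} \<times> Sigma {s..<n} ?R"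
    using assms by (auto simp: cells_def)
  moreover have "card ({..<m} \<times> Sigma {..<s} ?R \<union> {0::nat} \<times> Sigma {s..<n} ?R) =
      card ({..<m} \<times> Sigma {..<s} ?R) + card ({0::nat} \<times> Sigma {s..<n} ?R)"
    by (rule card_Un_disjoint) auto
  moreover have "\<dots> = m * (\<Sum>u<s. n - u) + (\<Sum>u = s..<n. n - u)"
    by (simp add: card_cartesian_product)
  moreover have "(\<Sum>u<s. n - u) = (\<Sum>u<s. 1 + (n - 1 - u))"
    using assms by (intro sum.cong) auto
  moreover have "\<dots> = s + lex_start n s"
    unfolding sum.distrib by (simp add: lex_start_def)
  moreover have "(\<Sum>u = s..<n. n - u) = (\<Sum>u = s..<n. 1 + (n - 1 - u))"
    by (intro sum.cong) auto
  moreover have "\<dots> = (n - s) + (\<Sum>u = s..<n. n - 1 - u)"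
    unfolding sum.distrib by simp
  moreover have "lex_start n s + (\<Sum>u = s..<n. n - 1 - u) = lex_start n n"
    using sum.atLeastLessThan_concat[of 0 s n "\<lambda>u. n - 1 - u"] assms
    by (simp add: lex_start_def lessThan_atLeast0)
  ultimately show ?thesis by (simp add: distrib_left)
qed

text \<open>
  Here \<open>s\<close> is the number of vertices of a copy outside the common \<open>K\<^sub>r\<close>, and \<open>r = n - s\<close>.
\<close>

locale label_pattern =
  fixes m n s :: nat
  assumes m: "2 \<le> m" and n: "odd n" and s: "1 \<le> s" "s + 3 \<le> n"
begin

text \<open>The rows below \<open>s'\<close> are those that have a partner.\<close>

definition s' :: nat where "s' = 2 * (s div 2)"

definition h :: nat where "h = m div 2"

text \<open>\<open>2 h + 1 = m + \<delta>\<close> is the width of the Kotzig array if \<open>s\<close> is odd; \<open>\<delta>\<close> counts its unused columns.\<close>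

definition \<delta> :: nat where "\<delta> = (if odd s \<and> even m then 1 else 0)"

abbreviation Q :: nat where "Q \<equiv> lex_start n s"

abbreviation ix :: "nat \<Rightarrow> nat \<Rightarrow> nat" where "ix \<equiv> lex_index n"

text \<open>
  The first label of the block of the \<open>p\<close>-th position. The labels below \<open>m * s\<close> belong to the
  diagonal entries of the rows below \<open>s\<close>.
  Blocks have length \<open>m\<close>, except that the three last ones, which carry the Kotzig array if \<open>s\<close> is
  odd, have length \<open>m + \<delta>\<close>; the truncated subtraction counts the longer blocks that precede \<open>p\<close>.
\<close>

definition start :: "nat \<Rightarrow> nat" where
  "start p = m * s + m * p + \<delta> * (p - (Q - 3))"

text \<open>The three positions that carry the Kotzig array, the last ones in the lexicographic order.\<close>

definition special :: "nat \<Rightarrow> nat \<Rightarrow> bool" where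
  "special u v \<longleftrightarrow> odd s \<and> u = s - 1 \<and> n - 3 \<le> v"

text \<open>
  The positions off the diagonal with slope \<open>1\<close>, those of the Kotzig array aside. A row \<open>u < s'\<close> has sign \<open>(-1)\<^sup>u\<^sup>+\<^sup>v\<close> in the columns \<open>v < s'\<close>,
  a symmetric choice, so that leaving out the diagonal the signs have sum \<open>-1\<close>. The columns
  \<open>s', s' + 1, s' + 2\<close> have the signs \<open>(-1)\<^sup>u, -1, -(-1)\<^sup>u\<close>, again with sum \<open>-1\<close>, and from
  \<open>s' + 3\<close> on signs alternate with sum \<open>0\<close>.
  Column \<open>s'\<close> belongs to the first case in order that in row \<open>s'\<close>, if it is an unpaired row, the signs
  are \<open>(-1)\<^sup>v\<close> throughout.
\<close>

definition up :: "nat \<Rightarrow> nat \<Rightarrow> bool" where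
  "up u v \<longleftrightarrow>
    (if u < s' \<and> v \<le> s' then even (u + v)
     else if u < s' \<and> v = s' + 2 then odd (u + v)
     else even v)"

definition offset :: "nat \<Rightarrow> nat \<Rightarrow> nat \<Rightarrow> nat" where
  "offset i u v =
    (if special u v then kotzig h (v - (n - 3)) i else if up u v then i else m - 1 - i)"

definition edge_label :: "nat \<Rightarrow> nat \<Rightarrow> nat \<Rightarrow> nat" where
  "edge_label i u v = start (ix u v) + offset i u v"

text \<open>
  Labels are counted from \<open>0\<close> here. The paired rows come with interleaved diagonal entries, an unpaired
  row with a block of its own. In the shared block, the first \<open>3 \<delta>\<close> diagonal entries take the labels that
  the blocks of the Kotzig array would give to a further copy \<open>m\<close>; the other diagonal entries and then
  the entries off the diagonal follow after all blocks.
\<close>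

definition lab :: "nat \<Rightarrow> nat \<Rightarrow> nat \<Rightarrow> nat" where
  "lab i u v =
    (if u = v then
       if u < s' then 2 * m * (u div 2) + 2 * i + u mod 2
       else if u < s then m * u + i
       else if u - s < 3 * \<delta> then edge_label m (s - 1) (n - 3 + (u - s))
       else start Q + (u - s) - 3 * \<delta>
     else if u < s then edge_label i u v
     else start Q + (n - s) - 3 * \<delta> + (ix u v - Q))"

lemma s'_cases: "even s' \<and> s' = s \<and> even s \<or> even s' \<and> Suc s' = s \<and> odd s"
  unfolding s'_def by presburger

lemma even_s': "even s'"
  by (simp add: s'_def)

lemma less_s'_iff: "w < s' \<longleftrightarrow> w div 2 < s div 2"
  unfolding s'_def by presburger

lemma delta_le: "\<delta> \<le> 1" by (simp add: \<delta>_def)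

lemma delta_room: "3 * \<delta> \<le> n - s"
  using s by (simp add: \<delta>_def le_diff_conv2)

lemma Q_ge: "3 \<le> Q"
proof -
  have "n - 1 - 0 \<le> Q" unfolding lex_start_def
    using s by (intro member_le_sum) auto
  then show ?thesis using s by simp
qed

lemma index_special: "t < 3 \<Longrightarrow> ix (s - 1) (n - 3 + t) = Q - 3 + t"
proof -
  have "Q = lex_start n (s - 1) + (n - s)"
    unfolding lex_start_def using s by (cases s) auto
  then show "t < 3 \<Longrightarrow> ?thesis" using s by (simp add: lex_index_def)
qed

lemma start_Suc: "start (Suc p) = start p + m + (if Q - 3 \<le> p then \<delta> else 0)"
  by (auto simp: start_def Suc_diff_le)

lemma start_mono: "p \<le> p' \<Longrightarrow> start p \<le> start p'"
  by (simp add: start_def add_mono mult_le_mono diff_le_mono)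

lemma start_Q: "start Q = m * s + m * Q + 3 * \<delta>"
  using Q_ge by (simp add: start_def)

text \<open>
  The copies for which the offset stays inside the block: besides the \<open>m\<close> actual ones, copy \<open>m\<close> for the
  unused column of the Kotzig array.
\<close>

definition valid :: "nat \<Rightarrow> nat \<Rightarrow> nat \<Rightarrow> bool" where
  "valid i u v \<longleftrightarrow> u < s \<and> u < v \<and> v < n \<and> (i < m \<or> \<delta> = 1 \<and> special u v \<and> i = m)"

lemma special_index:
  assumes "special u v" "v < n"
  shows "Q - 3 \<le> ix u v"
proof -
  have "v - (n - 3) < 3" "n - 3 + (v - (n - 3)) = v" "u = s - 1"
    using assms s by (auto simp: special_def)
  then show ?thesis using index_special[of "v - (n - 3)"] le_add1 by metis
qed

lemma special_range: "valid i u v \<Longrightarrow> special u v \<Longrightarrow> i \<le> 2 * h \<and> 2 * h < m + \<delta>"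
  unfolding valid_def special_def h_def \<delta>_def by (auto split: if_splits)

lemma offset_less: "valid i u v \<Longrightarrow> start (ix u v) + offset i u v < start (Suc (ix u v))"
proof -
  assume a: "valid i u v"
  show ?thesis
  proof (cases "special u v")
    case True
    then have "kotzig h (v - (n - 3)) i < m + \<delta>"
      using special_range[OF a True] kotzig_le le_less_trans by blast
    then show ?thesis using True special_index a by (simp add: offset_def start_Suc valid_def)
  next
    case False
    then show ?thesis using a by (auto simp: offset_def start_Suc valid_def)
  qed
qed

lemma edge_label_range: "valid i u v \<Longrightarrow> m * s \<le> edge_label i u v \<and> edge_label i u v < start Q"
proof -
  assume a: "valid i u v"
  then have "Suc (ix u v) \<le> Q" using lex_index_less_start by (simp add: valid_def Suc_le_eq)
  then have "edge_label i u v < start Q"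
    using offset_less[OF a] start_mono unfolding edge_label_def by (meson less_le_trans)
  then show ?thesis by (simp add: edge_label_def start_def)
qed

lemma edge_label_less: "valid i u v \<Longrightarrow> ix u v < ix u' v' \<Longrightarrow> edge_label i u v < edge_label i' u' v'"
  using offset_less[of i u v] start_mono[of "Suc (ix u v)" "ix u' v'"] by (simp add: edge_label_def)

lemma edge_label_inj:
  assumes "valid i u v" "valid i' u' v'" "edge_label i u v = edge_label i' u' v'"
  shows "i = i' \<and> u = u' \<and> v = v'"
proof -
  have "ix u v = ix u' v'"
    using edge_label_less[OF assms(1)] edge_label_less[OF assms(2)] assms(3) by (metis linorder_neqE_nat nat_neq_iff)
  then have uv: "u = u'" "v = v'"
    using lex_index_inj assms(1,2) unfolding valid_def by blast+
  with assms(3) have o: "offset i u v = offset i' u v" by (simp add: edge_label_def)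
  show ?thesis
  proof (cases "special u v")
    case True
    then show ?thesis
      using o special_range assms(1,2) uv kotzig_inj unfolding offset_def by metis
  next
    case False
    then show ?thesis using o assms(1,2) uv by (auto simp: offset_def valid_def split: if_splits)
  qed
qed

lemma copy_diag_range:
  assumes "u < s" "i < m"
  shows "lab i u u < m * s"
proof (cases "u < s'")
  case True
  have "2 * m * (u div 2) + 2 * i + u mod 2 < 2 * m * Suc (u div 2)"
    using assms(2) by simp
  also have "\<dots> \<le> 2 * m * (s div 2)"
    using True unfolding s'_def by (intro mult_le_mono) auto
  also have "\<dots> \<le> m * s" by (simp add: mult.assoc mult.left_commute)
  finally show ?thesis using True by (simp add: lab_def)
next
  case False
  then have "m * u + i < m * Suc u" "Suc u = s" using assms s'_cases by auto
  then show ?thesis using False assms by (simp add: lab_def)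
qed

text \<open>Diagonal entries of different pairs, even in different copies, lie in disjoint ranges.\<close>

lemma copy_diag_less:
  assumes "u < v" "v < s" "i < m" "k < m" "u div 2 < v div 2"
  shows "lab i u u < lab k v v"
proof -
  have u: "u < s'" using assms(1,2) s'_cases by auto
  have "2 * m * (u div 2) + 2 * i + u mod 2 < 2 * m * Suc (u div 2)"
    using assms(3) by simp
  also have "\<dots> \<le> 2 * m * (v div 2)"
    using assms(5) by (intro mult_le_mono) auto
  finally have 1: "lab i u u < 2 * m * (v div 2)" using u by (simp add: lab_def)
  show ?thesis
  proof (cases "v < s'")
    case True
    then show ?thesis using 1 by (simp add: lab_def)
  next
    case False
    have "2 * m * (v div 2) = m * (2 * (v div 2))" by simp
    also have "\<dots> \<le> m * v" by (intro mult_le_mono) auto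
    finally have "2 * m * (v div 2) \<le> m * v" .
    moreover have "lab k v v = m * v + k" using False assms(2) by (simp add: lab_def)
    ultimately show ?thesis using 1 by linarith
  qed
qed

lemma copy_diag_inj:
  assumes "u < s" "v < s" "i < m" "k < m" "lab i u u = lab k v v"
  shows "i = k \<and> u = v"
proof -
  have less: "a < b" if "a div 2 < b div 2" for a b :: nat
    using that div_le_mono[of b a 2] by linarith
  have "\<not> u div 2 < v div 2" using copy_diag_less[of u v i k] less[of u v] assms by auto
  moreover have "\<not> v div 2 < u div 2" using copy_diag_less[of v u k i] less[of v u] assms by auto
  ultimately have div: "u div 2 = v div 2" by linarith
  have "u < s' \<and> v < s' \<or> u = v \<and> \<not> u < s'"
  proof (cases "u < s'")
    case True
    then show ?thesis using div by (simp add: less_s'_iff)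
  next
    case False
    then have "\<not> v < s'" using div by (simp add: less_s'_iff)
    then show ?thesis using False assms(1,2) s'_cases by auto
  qed
  then consider "u < s'" "v < s'" | "u = v" "\<not> u < s'" by blast
  then show ?thesis
  proof cases
    case 1
    then have "2 * i + u mod 2 = 2 * k + v mod 2"
      using assms(5) div by (simp add: lab_def)
    moreover have "u mod 2 < 2" "v mod 2 < 2" by simp_all
    ultimately have "i = k" by linarith
    moreover from this have "u mod 2 = v mod 2"
      using \<open>2 * i + u mod 2 = 2 * k + v mod 2\<close> by simp
    ultimately show ?thesis using div by (metis mult_div_mod_eq)
  next
    case 2
    then show ?thesis using assms by (simp add: lab_def)
  qed
qed

lemma valid_hole: "k < 3 * \<delta> \<Longrightarrow> valid m (s - 1) (n - 3 + k)"
  using s by (auto simp: valid_def special_def \<delta>_def split: if_splits)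

lemma valid_cell: "i < m \<Longrightarrow> u < s \<Longrightarrow> u < v \<Longrightarrow> v < n \<Longrightarrow> valid i u v"
  by (simp add: valid_def)

definition total :: nat where
  "total = start Q + (n - s) - 3 * \<delta> + (lex_start n n - Q)"

lemma total_card: "total = card (cells m n s)"
  using card_cells[of s n m] m s start_Q by (simp add: total_def)

text \<open>From here on the labels belong to the edges of the common \<open>K\<^sub>r\<close>.\<close>

definition top :: nat where "top = start Q + (n - s) - 3 * \<delta>"

lemma starts_le: "m * s \<le> start Q" "start Q \<le> top"
  using start_Q delta_room by (auto simp: top_def)

text \<open>
  The kinds of positions with the ranges of their labels. Only the kinds \<open>copy_edge\<close> and \<open>hole\<close> share a
  range; both are values of \<open>edge_label\<close>, so that its injectivity separates them.
\<close>

lemma lab_cases: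
  assumes "i < m" "u \<le> v" "v < n"
  obtains (copy_diag) "u = v" "u < s" "lab i u v < m * s"
  | (copy_edge) "u < v" "u < s" "lab i u v = edge_label i u v" "valid i u v"
      "m * s \<le> lab i u v" "lab i u v < start Q"
  | (hole) "u = v" "s \<le> u" "lab i u v = edge_label m (s - 1) (n - 3 + (u - s))"
      "valid m (s - 1) (n - 3 + (u - s))" "u - s < 3 * \<delta>"
      "m * s \<le> lab i u v" "lab i u v < start Q"
  | (core_diag) "u = v" "s \<le> u" "3 * \<delta> \<le> u - s" "lab i u v + 3 * \<delta> = start Q + (u - s)"
      "start Q \<le> lab i u v" "lab i u v < top"
  | (core_edge) "u < v" "s \<le> u" "lab i u v + Q = top + ix u v" "top \<le> lab i u v"
proof -
  consider "u = v" "u < s" | "u < v" "u < s" | "u = v" "s \<le> u" "u - s < 3 * \<delta>"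
    | "u = v" "s \<le> u" "3 * \<delta> \<le> u - s" | "u < v" "s \<le> u"
    using assms by linarith
  then show thesis
  proof cases
    case 1
    then show thesis using copy_diag copy_diag_range assms(1) by simp
  next
    case 2
    then have "lab i u v = edge_label i u v" "valid i u v" using assms valid_cell by (auto simp: lab_def)
    then show thesis using copy_edge edge_label_range[of i u v] 2 by simp
  next
    case 3
    note v = valid_hole[OF 3(3)]
    have "\<not> u < s'" using 3 s'_cases by auto
    then have "lab i u v = edge_label m (s - 1) (n - 3 + (u - s))"
      using 3 by (simp add: lab_def)
    then show thesis using edge_label_range[OF v] by (intro hole 3 v) simp_all
  next
    case 4
    then have "\<not> u < s'" "\<not> u < s" "\<not> u - s < 3 * \<delta>" using s'_cases by auto
    then have "lab i u v = start Q + (u - s) - 3 * \<delta>"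
      using 4 unfolding lab_def by simp
    then have "lab i u v + 3 * \<delta> = start Q + (u - s)" using 4 by linarith
    then show thesis using 4 assms by (intro core_diag) (auto simp: top_def)
  next
    case 5
    then have "lab i u v = top + (ix u v - Q)" by (simp add: lab_def top_def)
    moreover have "Q \<le> ix u v" using 5 by (simp add: lex_start_le_index)
    ultimately show thesis using 5 by (intro core_edge) auto
  qed
qed

lemma lab_less_total:
  assumes "i < m" "u \<le> v" "v < n"
  shows "lab i u v < total"
using assms
proof (cases rule: lab_cases)
  case core_edge
  then show ?thesis using lex_index_less_start[of u v n n] assms lex_start_le_index[of s u n v]
    by (simp add: total_def top_def)
qed (use starts_le in \<open>auto simp: total_def top_def\<close>)

lemma lab_inj: "inj_on (\<lambda>(i, u, v). lab i u v) (cells m n s)"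
proof (rule inj_onI)
  fix x y
  assume xy: "x \<in> cells m n s" "y \<in> cells m n s"
    "(case x of (i, u, v) \<Rightarrow> lab i u v) = (case y of (i, u, v) \<Rightarrow> lab i u v)"
  obtain i u v where x: "x = (i, u, v)" by (cases x)
  obtain i' u' v' where y: "y = (i', u', v')" by (cases y)
  from xy have c: "(i, u, v) \<in> cells m n s" "(i', u', v') \<in> cells m n s"
    and eq: "lab i u v = lab i' u' v'" by (simp_all add: x y)
  from c have b: "i < m" "u \<le> v" "v < n" and b': "i' < m" "u' \<le> v'" "v' < n"
    and z: "s \<le> u \<Longrightarrow> i = 0" "s \<le> u' \<Longrightarrow> i' = 0" by (auto simp: cells_def)
  have "i = i' \<and> u = u' \<and> v = v'"
    using b
  proof (cases rule: lab_cases)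
    case copy_diag
    from b' have "u' = v' \<and> u' < s"
      by (cases rule: lab_cases) (use copy_diag eq starts_le in auto)
    then show ?thesis using copy_diag_inj[of u u' i i'] copy_diag b b' eq by simp
  next
    case copy_edge
    show ?thesis
      using b'
    proof (cases rule: lab_cases)
      case copy_edge': copy_edge
      show ?thesis using edge_label_inj[OF copy_edge(4) copy_edge'(4)] copy_edge(3) copy_edge'(3) eq by simp
    next
      case hole
      then show ?thesis using edge_label_inj[OF copy_edge(4) hole(4)] copy_edge(3) b eq by simp
    qed (use copy_edge eq starts_le in auto)
  next
    case hole
    show ?thesis
      using b'
    proof (cases rule: lab_cases)
      case copy_edge
      then show ?thesis using edge_label_inj[OF hole(4) copy_edge(4)] hole(3) b' eq by simp
    next
      case hole': hole
      then have "n - 3 + (u - s) = n - 3 + (u' - s)"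
        using edge_label_inj[OF hole(4) hole'(4)] hole(3) eq by simp
      then have "u = u'" using hole(2) hole'(2) by simp
      then show ?thesis using hole(1,2) hole'(1) z by simp
    qed (use hole eq starts_le in auto)
  next
    case core_diag
    from b' have "u' = v' \<and> s \<le> u' \<and> lab i' u' v' + 3 * \<delta> = start Q + (u' - s)"
      by (cases rule: lab_cases) (use core_diag eq starts_le in auto)
    then show ?thesis using core_diag eq z by auto
  next
    case core_edge
    from b' have *: "u' < v' \<and> s \<le> u' \<and> lab i' u' v' + Q = top + ix u' v'"
      by (cases rule: lab_cases) (use core_edge eq starts_le in auto)
    then have "ix u v = ix u' v'" using eq core_edge by linarith
    then show ?thesis using lex_index_inj[of u v n u' v'] core_edge * b b' z by auto
  qed
  then show "x = y" by (simp add: x y)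
qed

lemma lab_bij: "bij_betw (\<lambda>(i, u, v). Suc (lab i u v)) (cells m n s) {1..card (cells m n s)}"
proof -
  have inj: "inj_on (\<lambda>(i, u, v). Suc (lab i u v)) (cells m n s)"
    using lab_inj by (auto simp: inj_on_def)
  have "(\<lambda>(i, u, v). Suc (lab i u v)) ` cells m n s \<subseteq> {1..card (cells m n s)}"
    unfolding total_card[symmetric] using lab_less_total by (auto simp: cells_def Suc_le_eq)
  moreover have "card ((\<lambda>(i, u, v). Suc (lab i u v)) ` cells m n s) = card {1..card (cells m n s)}"
    using card_image[OF inj] by simp
  ultimately have "(\<lambda>(i, u, v). Suc (lab i u v)) ` cells m n s = {1..card (cells m n s)}"
    by (intro card_subset_eq) auto
  with inj show ?thesis by (simp add: bij_betw_def)
qed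

lemma lab_core: "s \<le> u \<Longrightarrow> lab i u v = lab 0 u v"
  using s'_cases by (auto simp: lab_def)

lemma lab_lex:
  assumes "i < m" "a < b" "b < n" "c < d" "d < n" "a < c \<or> a = c \<and> b < d"
  shows "lab i a b < lab i c d"
proof -
  have ix: "ix a b < ix c d" by (rule lex_index_mono[OF assms(2-4,6)])
  have ac: "a \<le> c" using assms(6) by auto
  consider "c < s" | "a < s" "s \<le> c" | "s \<le> a" by linarith
  then show ?thesis
  proof cases
    case 1
    then show ?thesis
      using edge_label_less[OF valid_cell ix] assms ac by (simp add: lab_def)
  next
    case 2
    then have "lab i a b < start Q" using edge_label_range[OF valid_cell] assms by (simp add: lab_def)
    also have "\<dots> \<le> lab i c d"
      using 2 assms starts_le by (simp add: lab_def top_def)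
    finally show ?thesis .
  next
    case 3
    then have "Q \<le> ix a b" by (rule lex_start_le_index)
    then show ?thesis using ix 3 ac assms by (simp add: lab_def)
  qed
qed

text \<open>
  The labels of the unused column of the Kotzig array are increasing because they come from three
  successive blocks, and they lie above the diagonal entries of the rows below \<open>s\<close>.
\<close>

lemma lab_diag:
  assumes "u < v" "v < n"
  shows "lab 0 u u < lab 0 v v"
proof -
  have m0: "0 < m" using m by simp
  consider "v < s" | "u < s" "s \<le> v" | "s \<le> u" by linarith
  then show ?thesis
  proof cases
    case 1
    show ?thesis
    proof (cases "u div 2 = v div 2")
      case True
      then have "u mod 2 < v mod 2"
        using assms(1) div_mult_mod_eq[of u 2] div_mult_mod_eq[of v 2] by linarith
      moreover have "u < s'" using 1 assms(1) s'_cases by auto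
      moreover from this have "v < s'" using True by (simp add: less_s'_iff)
      ultimately show ?thesis using True by (simp add: lab_def)
    next
      case False
      then have "u div 2 < v div 2" using div_le_mono[of u v 2] assms(1) by linarith
      then show ?thesis using copy_diag_less assms 1 m0 by simp
    qed
  next
    case 2
    then have "lab 0 u u < m * s" using copy_diag_range m0 by simp
    moreover have "m * s \<le> lab 0 v v"
      by (rule lab_cases[OF m0 order_refl assms(2)]) (use 2 starts_le in auto)
    ultimately show ?thesis by simp
  next
    case 3
    show ?thesis
    proof (cases "v - s < 3 * \<delta>")
      case True
      then have "u - s < 3 * \<delta>" "u - s < v - s" using assms 3 by auto
      moreover from True this have "u - s < 3" "v - s < 3" using delta_le by linarith+
      ultimately have "ix (s - 1) (n - 3 + (u - s)) < ix (s - 1) (n - 3 + (v - s))"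
        by (simp only: index_special)
      then have "edge_label m (s - 1) (n - 3 + (u - s)) < edge_label m (s - 1) (n - 3 + (v - s))"
        using \<open>u - s < 3 * \<delta>\<close> by (intro edge_label_less valid_hole)
      then show ?thesis using 3 assms True s'_cases by (auto simp: lab_def)
    next
      case False
      have v: "lab 0 v v + 3 * \<delta> = start Q + (v - s)" "start Q \<le> lab 0 v v"
        using lab_cases[OF m0 order_refl assms(2)] False 3 assms(1) by fastforce+
      have "u < n" using assms by simp
      from m0 order_refl this show ?thesis
        by (cases rule: lab_cases) (use v 3 assms in auto)
    qed
  qed
qed

section \<open>Constant row sums\<close>

text \<open>
  Twice the deviation of \<open>i\<close> from the mean of \<open>0, \<dots>, m - 1\<close>. Doubled labels are a
  constant plus slope times drift, which makes ascending and descending entries symmetric.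
\<close>

definition drift :: "nat \<Rightarrow> int" where "drift i = 2 * int i - (int m - 1)"

definition sgn_up :: "nat \<Rightarrow> nat \<Rightarrow> int" where "sgn_up u v = (if up u v then 1 else -1)"

lemma offset_drift:
  assumes "i < m" "\<not> special u v"
  shows "2 * int (offset i u v) = (int m - 1) + sgn_up u v * drift i"
  using assms by (auto simp: offset_def sgn_up_def drift_def of_nat_diff)

lemma lab_offdiag:
  assumes "i < m" "u < s" "v \<noteq> u" "\<not> special (min u v) (max u v)"
  shows "2 * int (lab i (min u v) (max u v)) =
    (2 * int (start (ix (min u v) (max u v))) + (int m - 1)) + sgn_up (min u v) (max u v) * drift i"
  using assms offset_drift[OF assms(1,4)] by (auto simp: lab_def edge_label_def min_def max_def)

text \<open>
  In a paired row all slopes, \<open>2\<close> on the diagonal and \<open>\<plusminus>1\<close> elsewhere, have sum \<open>0\<close>: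
  the columns below \<open>s'\<close> contribute \<open>1\<close>, the next three \<open>-1\<close>, and the others \<open>0\<close>.
\<close>

lemma row_sum_low:
  assumes u: "u < s'" and i: "i < m"
  shows "row_sum lab n i u = row_sum lab n 0 u"
proof -
  define S where "S v = (if v = u then 2 else sgn_up (min u v) (max u v))" for v
  define C where "C v = (if v = u then 2 * int (2 * m * (u div 2) + u mod 2) + 2 * (int m - 1)
      else 2 * int (start (ix (min u v) (max u v))) + (int m - 1))" for v
  have us: "u < s" using u s'_cases by auto
  have lab: "2 * int (lab k (min u v) (max u v)) = C v + S v * drift k" if "k < m" for k v
  proof (cases "v = u")
    case True
    then show ?thesis using u by (simp add: lab_def C_def S_def drift_def)
  next
    case False
    have "min u v < s'" using u by simp
    then have "\<not> special (min u v) (max u v)" using s'_cases by (auto simp: special_def)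
    then show ?thesis using lab_offdiag[OF that us False] False by (simp add: C_def S_def)
  qed
  have S_low: "S v = alt u * alt v + (if v = u then 1 else 0)" if "v \<in> {0..<s'}" for v
  proof (cases "v = u")
    case True
    then show ?thesis by (simp add: S_def alt_def)
  next
    case False
    have "min u v + max u v = u + v" by (simp add: min_def max_def)
    moreover have "min u v < s'" "max u v \<le> s'" using that u by auto
    ultimately have "up (min u v) (max u v) \<longleftrightarrow> even (u + v)" by (simp add: up_def)
    then show ?thesis using False by (simp add: S_def sgn_up_def alt_def)
  qed
  have S_mid: "S s' = alt u" "S (Suc s') = -1" "S (Suc (Suc s')) = - alt u"
    using u even_s' by (simp_all add: S_def sgn_up_def up_def alt_def)
  have S_high: "S v = alt v" if "v \<in> {s' + 3..<n}" for v
    using that u by (simp add: S_def sgn_up_def up_def alt_def)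
  have n3: "s' + 3 \<le> n" "even (n - (s' + 3))" using s n s'_cases by auto
  have "(\<Sum>v<n. S v) = (\<Sum>v = 0..<s'. S v) + (\<Sum>v = s'..<s' + 3. S v) + (\<Sum>v = s' + 3..<n. S v)"
    unfolding lessThan_atLeast0
    by (simp only: sum.atLeastLessThan_concat[OF le0 le_add1] sum.atLeastLessThan_concat[OF le0 n3(1)])
  also have "(\<Sum>v = 0..<s'. S v) = (\<Sum>v = 0..<s'. alt u * alt v + (if v = u then 1 else 0))"
    by (intro sum.cong S_low) auto
  also have "\<dots> = alt u * (\<Sum>v = 0..<s'. alt v) + 1"
    using u by (simp add: sum.distrib sum_distrib_left)
  also have "(\<Sum>v = 0..<s'. alt v) = 0" using s'_cases by (intro sum_alt_even) auto
  also have "(\<Sum>v = s'..<s' + 3. S v) = -1"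
    using S_mid by (simp add: numeral_3_eq_3)
  also have "(\<Sum>v = s' + 3..<n. S v) = (\<Sum>v = s' + 3..<n. alt v)"
    by (intro sum.cong S_high) auto
  also have "\<dots> = 0" using n3 by (intro sum_alt_even) auto
  finally have S0: "(\<Sum>v<n. S v) = 0" by simp
  have "2 * int (row_sum lab n k u) = (\<Sum>v<n. C v)" if "k < m" for k
  proof -
    have "2 * int (row_sum lab n k u) = (\<Sum>v<n. C v + S v * drift k)"
      unfolding row_sum_def of_nat_sum sum_distrib_left
      using lab[OF that] by (intro sum.cong) auto
    also have "\<dots> = (\<Sum>v<n. C v) + (\<Sum>v<n. S v) * drift k"
      by (simp add: sum.distrib sum_distrib_right)
    finally show ?thesis using S0 by simp
  qed
  from this[OF i] this[of 0] m show ?thesis by simp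
qed

text \<open>
  In the unpaired row the slopes of the columns below \<open>n - 3\<close>, the diagonal included, alternate, and there
  is an even number of them. The last three columns form the Kotzig array.
\<close>

lemma row_sum_last:
  assumes u: "Suc u = s" "odd s" and i: "i < m"
  shows "row_sum lab n i u = row_sum lab n 0 u"
proof -
  define C where "C v = (if v = u then 2 * int (m * u) + (int m - 1)
      else 2 * int (start (ix (min u v) (max u v))) + (int m - 1))" for v
  have us: "u = s'" "u < s" using u s'_cases by auto
  have n4: "s + 4 \<le> n" "even (n - 3)" using s n u(2) by presburger+
  have lab: "2 * int (lab k (min u v) (max u v)) = C v + alt v * drift k" if "k < m" "v < n - 3" for k v
  proof (cases "v = u")
    case True
    then show ?thesis using us(2) by (simp add: us(1) lab_def C_def alt_def drift_def s'_def)
  next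
    case False
    have "\<not> special (min u v) (max u v)" using that(2) n4 u by (auto simp: special_def)
    moreover have "sgn_up (min u v) (max u v) = alt v"
      using False us u even_s' by (auto simp: sgn_up_def up_def alt_def min_def max_def)
    ultimately show ?thesis using lab_offdiag[OF that(1) us(2) False] False by (simp add: C_def)
  qed
  have top: "lab k (min u (n - 3 + t)) (max u (n - 3 + t)) = start (Q - 3 + t) + kotzig h t k"
    if "t < 3" for t k
  proof -
    have "u < n - 3 + t" "u = s - 1" using n4 u by auto
    then show ?thesis using that u s(1) index_special[OF that]
      by (simp add: lab_def edge_label_def offset_def special_def)
  qed
  have "2 * int (row_sum lab n k u) = (\<Sum>v = 0..<n - 3. C v) +
    2 * (int (start (Q - 3)) + int (start (Q - 3 + 1)) + int (start (Q - 3 + 2)) + 3 * int h)"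
    if k: "k < m" for k
  proof -
    let ?f = "\<lambda>v. lab k (min u v) (max u v)"
    have "row_sum lab n k u = (\<Sum>v = 0..<n - 3. ?f v) + (\<Sum>v = n - 3..<n - 3 + 3. ?f v)"
      unfolding row_sum_def lessThan_atLeast0 using n4 by (simp add: sum.atLeastLessThan_concat)
    moreover have "(\<Sum>v = n - 3..<n - 3 + 3. ?f v) = ?f (n - 3 + 0) + ?f (n - 3 + 1) + ?f (n - 3 + 2)"
      by (simp add: numeral_3_eq_3)
    moreover have "\<dots> = start (Q - 3 + 0) + start (Q - 3 + 1) + start (Q - 3 + 2) + 3 * h"
    proof -
      have "k \<le> 2 * h" using k unfolding h_def by presburger
      then show ?thesis using kotzig_sum[of k h] by (simp only: top) simp
    qed
    moreover have "2 * int (\<Sum>v = 0..<n - 3. ?f v) = (\<Sum>v = 0..<n - 3. C v + alt v * drift k)"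
      unfolding of_nat_sum sum_distrib_left using lab[OF k] by (intro sum.cong) auto
    moreover have "\<dots> = (\<Sum>v = 0..<n - 3. C v) + (\<Sum>v = 0..<n - 3. alt v) * drift k"
      by (simp add: sum.distrib sum_distrib_right)
    moreover have "(\<Sum>v = 0..<n - 3. alt v) = 0" using n4 by (intro sum_alt_even) auto
    ultimately show ?thesis by simp
  qed
  from this[OF i] this[of 0] m show ?thesis by simp
qed

lemma row_sum_const:
  assumes "i < m" "u < s"
  shows "row_sum lab n i u = row_sum lab n 0 u"
  using row_sum_low[of u i] row_sum_last[of u i] assms s'_cases by (metis not_less_eq less_SucE)

lemma row_sum_Suc: "row_sum (\<lambda>i u v. Suc (lab i u v)) n i u = row_sum lab n i u + n"
  unfolding row_sum_def Suc_eq_plus1 sum.distrib by simp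

end

theorem theorem2p6:
  fixes m n r :: nat
  assumes "m \<ge> 2"
    and "n \<ge> 3"
    and "odd n"
    and "r \<ge> 3"
    and "r < n"
  shows "chi_lat (amalgamation m n r) = n"
proof -
  interpret label_pattern m n "n - r" using assms by unfold_locales auto
  obtain f where "local_antimagic_total (amalgamation m n r) f"
    "card (weight (amalgamation m n r) f ` verts (amalgamation m n r)) = n"
  proof (rule labeling_of_pattern[where m = m and n = n and r = r and
        L = "\<lambda>i u v. Suc (lab i u v)", OF _ assms(5) refl lab_bij])
    show "Suc (lab i u v) = Suc (lab 0 u v)" if "n - r \<le> u" for i u v
      using lab_core[OF that] by simp
    show "row_sum (\<lambda>i u v. Suc (lab i u v)) n i u = row_sum (\<lambda>i u v. Suc (lab i u v)) n 0 u"
      if "i < m" "u < n - r" for i u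
      using row_sum_const[OF that] by (simp add: row_sum_Suc)
  qed (use assms lab_lex lab_diag in auto)
  then show ?thesis
    unfolding chi_lat_def using assms
    by (intro Least_equality) (auto intro: amalgamation_weights_ge)
qed

end
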